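(* Let $m,n\ge1$, let $b\in\mathbb R^m$ be such that $P(b)$ is non-empty, and set $\Gamma=\Gamma(\mathcal L^n,b)$. Let $F:\mathcal L^n\to\mathbb R$ be the European function defined by $\ell$-positive vectors $u_1,\dots,u_r$ with $u_j=u_j^+$ and numbers $s_1,\dots,s_r,C\ge0$, i.e. $$F(\lambda_1\cdots\lambda_n)=\Big(\sum_{j=1}^r s_j\,u_j(\lambda_1)\cdots u_j(\lambda_n)-C\Big)^+ .$$ Put $\beta(0)=1$ and $\beta(i)=\frac{1+b(i)}2$ for $1\le i\le m$, and for $1\le j\le r$ put $\alpha_j(0)=u_j(\nu_0)$ and $\alpha_j(i)=u_j(\nu_i)-u_j(\nu_0)$ for $1\le i\le m$. Then $$F_{\min}(\Gamma)\ \ge\ \sum_{k_0+\dots+k_m=n}\frac{n!}{k_0!\cdots k_m!}\,\beta(0)^{k_0}\cdots\beta(m)^{k_m}\Big(\sum_{j=1}^r s_j\,\alpha_j(0)^{k_0}\cdots\alpha_j(m)^{k_m}-C\Big)^+ ,$$ where the sum runs over tuples of non-negative integers with sum $n$.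
   Context: Fix an integer $m\ge1$. $\mathcal L$ is the set of all functions $\lambda:\{1,\dots,m\}\to\{0,1\}$, with the convention $\lambda(0)=0$. $\mathbb R^{\mathcal L}$ is the space of functions $\mathcal L\to\mathbb R$ with standard inner product $\langle\ ,\ \rangle$. For $0\le i\le m$ let $\ell_i(\lambda)=(-1)^{\lambda(i)}$ (so $\ell_0$ is constant $1$). For $b\in\mathbb R^m$, $P(b)=\{x\in\mathbb R^{\mathcal L}: x(\lambda)\ge 0\ \forall\lambda,\ \langle \ell_0,x\rangle=1,\ \langle \ell_i,x\rangle=b(i)\text{ for }1\le i\le m\}$, a set of probability density functions on $\mathcal L$. A vector $\sum_{i=0}^m a_i\ell_i$ is $\ell$-positive if $a_1,\dots,a_m>0$ ($a_0\in\mathbb R$ arbitrary). For $t\in\mathbb R$, $t^+=\max\{t,0\}$, and $v^+(\lambda)=v(\lambda)^+$ for $v\in\mathbb R^{\mathcal L}$. Elements of $\mathcal L^n$ are regarded as words of length $n$. Let $\mathcal T^*$ be the set of words of length $<n$ in the alphabet $\mathcal L$. For $\Phi:\mathcal T^*\to P(b)$ let $P(\Phi)$ be the probability density on $\mathcal L^n$ given by $P(\Phi)(\lambda_1\cdots\lambda_n)=\prod_{k=1}^n\Phi(\lambda_1\cdots\lambda_{k-1})(\lambda_k)$, and $\Gamma(\mathcal L^n,b)=\{P(\Phi):\Phi:\mathcal T^*\to P(b)\}$. $F_{\min}(\Gamma)$ is the minimum of the expectation $E_P(F)$ over $P\in\Gamma$. $\nu_i\in\mathcal L$ ($0\le i\le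 m$) is $\nu_i(j)=1-\delta_{ij}$ for $1\le j\le m$ (so $\nu_0$ is constant $1$). Convention: $0^0=1$. *)

theory Defs
  imports "HOL-Analysis.Analysis"
begin

text \<open>
  The index set \<open>{1,\<dots>,m}\<close> is a finite type \<open>'m\<close>, so \<open>m = CARD('m) \<ge> 1\<close>, and the index set
  \<open>{0,\<dots>,m}\<close> is \<open>'m option\<close>, with \<open>None\<close> in the role of \<open>0\<close>.  The set \<open>\<L>\<close> is the
  type \<open>'m \<Rightarrow> bool\<close>, with \<open>False\<close> and \<open>True\<close> for the values \<open>0\<close> and \<open>1\<close>, and the Euclidean space
  of real functions on \<open>\<L>\<close> is \<open>real ^ ('m \<Rightarrow> bool)\<close>.
\<close>

type_synonym 'm letter = "'m \<Rightarrow> bool"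

text \<open>The extension of a letter to the index \<open>0\<close> by the convention that its value there is \<open>0\<close>.\<close>

definition letter_at :: "'m letter \<Rightarrow> 'm option \<Rightarrow> nat" where
  "letter_at l i = (case i of None \<Rightarrow> 0 | Some j \<Rightarrow> of_bool (l j))"

definition ell :: "'m option \<Rightarrow> real ^ ('m::finite letter)" where
  "ell i = (\<chi> l. (-1) ^ letter_at l i)"

definition densities :: "real ^ 'm \<Rightarrow> (real ^ ('m::finite letter)) set" where
  "densities b = {x. (\<forall>l. 0 \<le> x $ l) \<and> ell None \<bullet> x = 1 \<and> (\<forall>i. ell (Some i) \<bullet> x = b $ i)}"

definition ell_positive :: "real ^ ('m::finite letter) \<Rightarrow> bool" where
  "ell_positive v \<longleftrightarrow>
     (\<exists>a :: 'm option \<Rightarrow> real. (\<forall>i. 0 < a (Some i)) \<and> v = (\<Sum>i\<in>UNIV. a i *\<^sub>R ell i))"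

definition pos :: "real \<Rightarrow> real" where
  "pos t = max t 0"

definition pos_vec :: "real ^ ('m::finite letter) \<Rightarrow> real ^ ('m letter)" where
  "pos_vec v = (\<chi> l. pos (v $ l))"

definition words :: "nat \<Rightarrow> 'm letter list set" where
  "words n = {w. length w = n}"

definition short_words :: "nat \<Rightarrow> 'm letter list set" where
  "short_words n = {w. length w < n}"

text \<open>
  With zero-based positions, the factor for the letter \<open>w ! k\<close> is the density that \<open>\<Phi>\<close> attaches to
  the prefix \<open>take k w\<close> preceding it.
\<close>

definition word_density ::
    "nat \<Rightarrow> ('m letter list \<Rightarrow> real ^ ('m::finite letter)) \<Rightarrow> 'm letter list \<Rightarrow> real" where
  "word_density n \<Phi> = (\<lambda>w\<in>words n. \<Prod>k<n. \<Phi> (take k w) $ (w ! k))"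

definition strategy_densities :: "nat \<Rightarrow> real ^ 'm \<Rightarrow> ('m::finite letter list \<Rightarrow> real) set" where
  "strategy_densities n b = word_density n ` (short_words n \<rightarrow> densities b)"

definition expect :: "nat \<Rightarrow> ('m::finite letter list \<Rightarrow> real) \<Rightarrow> ('m letter list \<Rightarrow> real) \<Rightarrow> real" where
  "expect n P F = (\<Sum>w\<in>words n. P w * F w)"

text \<open>The minimum (not merely the infimum) of the expectation: the least element of its range.\<close>

definition F_min ::
    "nat \<Rightarrow> ('m::finite letter list \<Rightarrow> real) set \<Rightarrow> ('m letter list \<Rightarrow> real) \<Rightarrow> real" where
  "F_min n G F = (LEAST y. y \<in> (\<lambda>P. expect n P F) ` G)"

definition european ::
    "nat \<Rightarrow> (nat \<Rightarrow> real) \<Rightarrow> (nat \<Rightarrow> real ^ ('m::finite letter)) \<Rightarrow> real \<Rightarrow> 'm letter list \<Rightarrow> real" where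
  "european r s u C w = pos ((\<Sum>j=1..r. s j * (\<Prod>k<length w. u j $ (w ! k))) - C)"

text \<open>The value of \<open>nu i\<close> at \<open>j\<close> is one minus the Kronecker delta.\<close>

definition nu :: "'m option \<Rightarrow> 'm letter" where
  "nu i = (\<lambda>j. i \<noteq> Some j)"

definition beta :: "real ^ 'm::finite \<Rightarrow> 'm option \<Rightarrow> real" where
  "beta b i = (case i of None \<Rightarrow> 1 | Some j \<Rightarrow> (1 + b $ j) / 2)"

definition alpha :: "real ^ ('m::finite letter) \<Rightarrow> 'm option \<Rightarrow> real" where
  "alpha v i = (case i of None \<Rightarrow> v $ nu None | Some j \<Rightarrow> v $ nu (Some j) - v $ nu None)"

end

theory Submission
  imports Defs "HOL-Combinatorics.Multiset_Permutations"
begin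

text \<open>
  An \<open>\<ell>\<close>-positive vector \<open>v = v\<^sup>+\<close> is the combination of the indicators of \<open>letter_at l i = 0\<close> with
  the nonnegative coefficients \<open>alpha v i\<close>.  Expanding the products, the European function is the
  positive part of \<open>(\<Sum>w. I w * A w) - C\<close>, where \<open>w\<close> runs over the words of length \<open>n\<close> in the indices
  \<open>0,\<dots>,m\<close>, \<open>I w\<close> is an indicator and \<open>A w\<close> is nonnegative.  As \<open>C \<ge> 0\<close>, the map \<open>t \<mapsto> (t - C)\<^sup>+\<close> is
  superadditive on nonnegative reals, so the function is at least \<open>\<Sum>w. I w * (A w - C)\<^sup>+\<close>.  The
  expectation of \<open>I w\<close> is the product of the \<open>beta b (w ! k)\<close> for every strategy, and the words with
  given letter counts are counted by a multinomial coefficient.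
\<close>

section \<open>Sums over words and multinomial counting\<close>

lemma finite_words: "finite {w :: 'a::finite list. length w = n}"
  using finite_lists_length_eq[of "UNIV :: 'a set" n] by simp

text \<open>The last letter is split off rather than the first because the factors of a strategy
  depend on prefixes.\<close>

lemma sum_words_Suc:
  fixes g :: "'a::finite list \<Rightarrow> 'b::comm_monoid_add"
  shows "(\<Sum>w | length w = Suc n. g w) = (\<Sum>w | length w = n. \<Sum>x\<in>UNIV. g (w @ [x]))"
proof -
  have bij: "bij_betw (\<lambda>(w, x). w @ [x]) ({w :: 'a list. length w = n} \<times> UNIV) {w. length w = Suc n}"
    by (rule bij_betw_byWitness[where f' = "\<lambda>w. (butlast w, last w)"])
       (auto intro!: append_butlast_last_id)
  have "(\<Sum>w | length w = Suc n. g w) = (\<Sum>p\<in>{w. length w = n} \<times> UNIV. case p of (w, x) \<Rightarrow> g (w @ [x]))"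
    by (subst sum.reindex_bij_betw[OF bij, symmetric]) (simp add: case_prod_unfold)
  then show ?thesis
    by (simp add: sum.cartesian_product)
qed

lemma prod_sum_words:
  fixes f :: "nat \<Rightarrow> 'a::finite \<Rightarrow> 'b::comm_semiring_1"
  shows "(\<Prod>k<n. \<Sum>i\<in>UNIV. f k i) = (\<Sum>w | length w = n. \<Prod>k<n. f k (w ! k))"
proof (induction n)
  case (Suc n)
  have "(\<Prod>k<n. f k ((w @ [x]) ! k)) = (\<Prod>k<n. f k (w ! k))" if "length w = n" for w :: "'a list" and x
    using that by (intro prod.cong) (auto simp: nth_append)
  then show ?case
    by (simp add: Suc.IH sum_words_Suc sum_product nth_append)
qed simp

lemma prod_nth_eq_prod_power_count:
  fixes f :: "'a::finite \<Rightarrow> 'b::comm_monoid_mult"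
  assumes "length w = n"
  shows "(\<Prod>k<n. f (w ! k)) = (\<Prod>i\<in>UNIV. f i ^ count (mset w) i)"
  using assms
proof (induction w arbitrary: n)
  case (Cons x w)
  have "(\<Prod>i\<in>UNIV. f i ^ count (mset (x # w)) i)
      = (\<Prod>i\<in>UNIV. (if i = x then f i else 1) * f i ^ count (mset w) i)"
    by (intro prod.cong) auto
  also have "\<dots> = f x * (\<Prod>k<length w. f (w ! k))"
    by (simp add: prod.distrib Cons.IH[OF refl])
  also have "\<dots> = (\<Prod>k<n. f ((x # w) ! k))"
    using Cons.prems by (auto simp: prod.lessThan_Suc_shift simp del: prod.lessThan_Suc)
  finally show ?case ..
qed simp

text \<open>These words are the permutations of the multiset with multiplicities
  \<open>k\<close>.\<close>

lemma card_words_count: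
  fixes k :: "'a::finite \<Rightarrow> nat"
  assumes "(\<Sum>i\<in>UNIV. k i) = n"
  shows "real (card {w. length w = n \<and> count (mset w) = k}) = fact n / (\<Prod>i\<in>UNIV. fact (k i))"
proof -
  define A where "A = Abs_multiset k"
  have count_A: "count A = k"
    by (simp add: A_def Abs_multiset_inverse)
  have size_A: "size A = n"
    unfolding size_multiset_overloaded_eq assms[symmetric] count_A[symmetric]
    by (rule sum.mono_neutral_left) (auto simp: not_in_iff)
  have "{w. length w = n \<and> count (mset w) = k} = permutations_of_multiset A"
    unfolding permutations_of_multiset_def count_A[symmetric]
    using size_A by (auto simp: count_inject simp flip: size_mset)
  \<comment> \<open>Letters that do not occur contribute \<open>fact 0 = 1\<close>.\<close>
  moreover have "(\<Prod>i\<in>set_mset A. fact (count A i) :: nat) = (\<Prod>i\<in>UNIV. fact (k i))"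
    unfolding count_A[symmetric] by (rule prod.mono_neutral_left) (auto simp: not_in_iff)
  ultimately show ?thesis
    using card_permutations_of_multiset[of A] size_A
    by (simp add: real_of_nat_div)
qed

lemma sum_words_count:
  fixes G :: "('a::finite \<Rightarrow> nat) \<Rightarrow> real"
  shows "(\<Sum>w :: 'a list | length w = n. G (count (mset w)))
    = (\<Sum>k | (\<Sum>i\<in>UNIV. k i) = n. fact n / (\<Prod>i\<in>UNIV. fact (k i)) * G k)"
proof -
  let ?T = "{k :: 'a \<Rightarrow> nat. (\<Sum>i\<in>UNIV. k i) = n}"
  \<comment> \<open>Each count is at most the total \<open>n\<close>, which makes \<open>?T\<close>
    finite.\<close>
  have "?T \<subseteq> (UNIV :: 'a set) \<rightarrow>\<^sub>E {..n}"
    by (auto intro: member_le_sum)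
  then have fin: "finite ?T"
    by (rule finite_subset) (intro finite_PiE, auto)
  have sub: "(\<lambda>w. count (mset w)) ` {w :: 'a list. length w = n} \<subseteq> ?T"
  proof safe
    fix w :: "'a list"
    have "length w = size (mset w)"
      by simp
    also have "\<dots> = (\<Sum>i\<in>UNIV. count (mset w) i)"
      unfolding size_multiset_overloaded_eq
      by (rule sum.mono_neutral_left) (auto simp: count_list_0_iff)
    finally show "(\<Sum>i\<in>UNIV. count (mset w) i) = length w" ..
  qed
  have "(\<Sum>w :: 'a list | length w = n. G (count (mset w)))
      = (\<Sum>k\<in>?T. \<Sum>w | w \<in> {w. length w = n} \<and> count (mset w) = k. G (count (mset w)))"
    by (rule sum.group[OF finite_words fin sub, symmetric])
  also have "\<dots> = (\<Sum>k\<in>?T. real (card {w. length w = n \<and> count (mset w) = k}) * G k)"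
    by (intro sum.cong refl) simp
  also have "\<dots> = (\<Sum>k\<in>?T. fact n / (\<Prod>i\<in>UNIV. fact (k i)) * G k)"
    by (intro sum.cong refl) (simp add: card_words_count)
  finally show ?thesis .
qed

text \<open>For two summands above \<open>C\<close> the left side subtracts \<open>C\<close> twice
  and the right side once; a summand below \<open>C\<close> gives 0 on the left and only increases
  the right.\<close>

lemma pos_sum_ge:
  assumes "finite A" and "\<And>x. x \<in> A \<Longrightarrow> 0 \<le> f x" and "0 \<le> C"
  shows "(\<Sum>x\<in>A. pos (f x - C)) \<le> pos ((\<Sum>x\<in>A. f x) - C)"
  using assms
proof (induction A rule: finite_induct)
  case (insert x A)
  have "0 \<le> f x" and "0 \<le> sum f A"
    using insert.prems by (auto intro: sum_nonneg)
  then show ?case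
    using insert by (fastforce simp: pos_def max_def split: if_splits)
qed (simp add: pos_def)

section \<open>Indicator expansions and their expectations\<close>

abbreviation zero_ind :: "'m::finite letter \<Rightarrow> 'm option \<Rightarrow> real" where
  "zero_ind l i \<equiv> of_bool (letter_at l i = 0)"

lemma ell_nth: "ell i $ l = 2 * zero_ind l i - 1"
  by (auto simp: ell_def letter_at_def split: option.split)

lemma sum_option: "(\<Sum>i\<in>UNIV. f i) = f None + (\<Sum>i\<in>UNIV. f (Some i))"
  for f :: "'a::finite option \<Rightarrow> 'b::comm_monoid_add"
  by (simp add: UNIV_option_conv sum.reindex)

text \<open>Substituting \<open>ell i = 2 * zero_ind - 1\<close> gives coefficients
  \<open>2 * a (Some i)\<close>, positive by assumption, and a constant term. The latter is the
  value of \<open>v\<close> at \<open>nu None\<close>, where every other indicator vanishes, so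
  \<open>v = pos_vec v\<close> makes it nonnegative.\<close>

lemma
  assumes "ell_positive v"
  shows ell_positive_expand: "v $ l = (\<Sum>i\<in>UNIV. alpha v i * zero_ind l i)"
    and alpha_nonneg: "v = pos_vec v \<Longrightarrow> 0 \<le> alpha v i"
proof -
  obtain a :: "'a option \<Rightarrow> real"
    where a: "\<And>i. 0 < a (Some i)" and v: "v = (\<Sum>i\<in>UNIV. a i *\<^sub>R ell i)"
    using assms unfolding ell_positive_def by blast
  have nth: "v $ l = a None + (\<Sum>i\<in>UNIV. a (Some i) * (2 * zero_ind l (Some i) - 1))" for l
    by (simp add: v sum_option ell_nth) (simp add: letter_at_def)
  have alpha_Some: "alpha v (Some j) = 2 * a (Some j)" for j
  proof -
    \<comment> \<open>\<open>nu (Some j)\<close> and \<open>nu None\<close> differ only at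
      \<open>j\<close>, where the term changes from \<open>- a (Some j)\<close> to
      \<open>a (Some j)\<close>.\<close>
    have "alpha v (Some j) = (\<Sum>i\<in>UNIV. if i = j then 2 * a (Some i) else 0)"
      unfolding alpha_def option.case nth
      unfolding add_diff_add sum_subtractf[symmetric] diff_self add_0_left
      by (intro sum.cong) (auto simp: nu_def letter_at_def)
    then show ?thesis
      by simp
  qed
  have alpha_None: "alpha v None = a None - (\<Sum>i\<in>UNIV. a (Some i))"
    by (simp add: alpha_def nth nu_def letter_at_def sum_negf)
  show "v $ l = (\<Sum>i\<in>UNIV. alpha v i * zero_ind l i)"
    by (simp add: nth sum_option alpha_None alpha_Some right_diff_distrib sum_subtractf mult_ac)
       (simp add: letter_at_def)
  show "0 \<le> alpha v i" if "v = pos_vec v"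
  proof (cases i)
    case None
    have "v $ nu None = pos (v $ nu None)"
      by (subst that) (simp add: pos_vec_def)
    then show ?thesis
      by (simp add: None alpha_def pos_def)
  next
    case (Some j)
    then show ?thesis
      using a[of j] by (simp add: alpha_Some)
  qed
qed

text \<open>The indicator is \<open>(1 + ell i) / 2\<close>, so the constraints defining
  \<open>densities b\<close> fix its expectation.\<close>

lemma densities_expect_zero_ind:
  assumes "x \<in> densities b"
  shows "(\<Sum>l\<in>UNIV. x $ l * zero_ind l i) = beta b i"
proof -
  have total: "(\<Sum>l\<in>UNIV. x $ l) = 1"
    using assms by (simp add: densities_def inner_vec_def ell_nth letter_at_def)
  have "(\<Sum>l\<in>UNIV. x $ l * zero_ind l i) = ((\<Sum>l\<in>UNIV. x $ l) + ell i \<bullet> x) / 2"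
    unfolding inner_vec_def ell_nth sum.distrib[symmetric] sum_divide_distrib
    by (intro sum.cong) (auto simp: algebra_simps)
  also have "\<dots> = beta b i"
    using assms unfolding total by (cases i) (auto simp: densities_def beta_def)
  finally show ?thesis .
qed

text \<open>Given any prefix, the last indicator has conditional expectation
  \<open>beta b (c n)\<close> whatever density the strategy picks there, so this factor splits off
  in the induction.\<close>

lemma expect_zero_ind:
  assumes "\<Phi> \<in> short_words n \<rightarrow> densities b"
  shows "(\<Sum>w | length w = n. (\<Prod>k<n. \<Phi> (take k w) $ (w ! k)) * (\<Prod>k<n. zero_ind (w ! k) (c k)))
    = (\<Prod>k<n. beta b (c k))"
  using assms
proof (induction n)
  case (Suc n)
  let ?p = "\<lambda>w. (\<Prod>k<n. \<Phi> (take k w) $ (w ! k)) * (\<Prod>k<n. zero_ind (w ! k) (c k))"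
  have snoc: "?p (w @ [l]) = ?p w" if "length w = n" for w l
    using that by (intro arg_cong2[where f = "(*)"] prod.cong) (auto simp: nth_append)
  have \<Phi>: "\<Phi> \<in> short_words n \<rightarrow> densities b"
    using Suc.prems by (auto simp: short_words_def)
  have "(\<Sum>l\<in>UNIV. (\<Prod>k<Suc n. \<Phi> (take k (w @ [l])) $ ((w @ [l]) ! k)) *
          (\<Prod>k<Suc n. zero_ind ((w @ [l]) ! k) (c k))) = ?p w * beta b (c n)"
    if w: "length w = n" for w
  proof -
    have "\<Phi> w \<in> densities b"
      using Suc.prems w by (auto simp: short_words_def)
    then have "?p w * beta b (c n) = (\<Sum>l\<in>UNIV. ?p w * (\<Phi> w $ l * zero_ind l (c n)))"
      by (simp only: densities_expect_zero_ind[symmetric] sum_distrib_left)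
    also have "\<dots> = (\<Sum>l\<in>UNIV. ?p (w @ [l]) * (\<Phi> w $ l * zero_ind l (c n)))"
      by (simp only: snoc[OF w])
    moreover have "(w @ [l]) ! n = l" for l
      using w by auto
    ultimately show ?thesis
      using w by (simp add: mult_ac)
  qed
  then show ?case
    by (simp add: sum_words_Suc Suc.IH[OF \<Phi>] sum_distrib_right[symmetric] del: prod.lessThan_Suc)
       simp
qed simp

section \<open>Existence of the minimum\<close>

lemma compact_densities: "compact (densities b)"
proof -
  have "closed (densities b)"
    unfolding densities_def
    by (intro closed_Collect_conj closed_Collect_all closed_Collect_le closed_Collect_eq
        continuous_intros)
  moreover have "densities b \<subseteq> cbox 0 (\<chi> l. 1)"
  proof
    fix x
    assume x: "x \<in> densities b"
    then have nonneg: "\<And>l. 0 \<le> x $ l" and total: "(\<Sum>l\<in>UNIV. x $ l) = 1"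
      by (simp_all add: densities_def inner_vec_def ell_nth letter_at_def)
    have "x $ l \<le> 1" for l
      unfolding total[symmetric] by (rule member_le_sum) (auto simp: nonneg)
    with nonneg show "x \<in> cbox 0 (\<chi> l. 1)"
      by (simp add: mem_box_cart)
  qed
  ultimately show ?thesis
    by (meson bounded_cbox bounded_subset compact_eq_bounded_closed)
qed

text \<open>\<open>F_min\<close> is a \<open>LEAST\<close>, so it is informative only once a minimum
  is known to exist. The expectation is continuous in the strategy, and the strategies form a
  compact product by Tychonoff.\<close>

lemma F_min_attained:
  fixes b :: "real ^ 'm::finite"
  assumes "densities b \<noteq> {}"
  obtains P where "P \<in> strategy_densities n b" and "F_min n (strategy_densities n b) F = expect n P F"
proof -
  let ?E = "\<lambda>\<Phi>. expect n (word_density n \<Phi>) F"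
  \<comment> \<open>Strategies on all words make \<open>K\<close> a product over
    \<open>UNIV\<close>, compact in the topology of the function type.\<close>
  define K where "K = (UNIV :: 'm letter list set) \<rightarrow>\<^sub>E densities b"
  have E_eq: "?E \<Phi> = (\<Sum>w\<in>words n. (\<Prod>k<n. \<Phi> (take k w) $ (w ! k)) * F w)" for \<Phi>
    by (simp add: expect_def word_density_def)
  obtain x where x: "x \<in> densities b"
    using assms by blast
  have "compactin (product_topology (\<lambda>_. euclidean) UNIV) K"
    unfolding K_def by (simp add: compactin_PiE compact_densities)
  then have "compact K"
    by (simp add: euclidean_product_topology)
  moreover have "K \<noteq> {}"
    using x unfolding K_def by (auto simp: PiE_eq_empty_iff)
  moreover have "continuous_on K ?E"
    unfolding E_eq
    by (intro continuous_intros continuous_on_product_then_coordinatewise)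
  ultimately obtain \<Phi> where \<Phi>: "\<Phi> \<in> K" and min: "\<And>\<Psi>. \<Psi> \<in> K \<Longrightarrow> ?E \<Phi> \<le> ?E \<Psi>"
    using continuous_attains_inf[of K ?E] by blast
  have least: "?E \<Phi> \<le> ?E \<Psi>" if \<Psi>: "\<Psi> \<in> short_words n \<rightarrow> densities b" for \<Psi>
  proof -
    \<comment> \<open>Only prefixes shorter than \<open>n\<close> are read, so the filler value
      \<open>x\<close> elsewhere does not affect the expectation.\<close>
    define \<Psi>' where "\<Psi>' = (\<lambda>w. if w \<in> short_words n then \<Psi> w else x)"
    have "?E \<Psi>' = ?E \<Psi>"
      unfolding E_eq \<Psi>'_def
      by (intro sum.cong arg_cong2[where f = "(*)"] prod.cong) (auto simp: short_words_def words_def)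
    moreover have "\<Psi>' \<in> K"
      using \<Psi> x by (auto simp: K_def \<Psi>'_def)
    ultimately show ?thesis
      using min[of \<Psi>'] by simp
  qed
  have mem: "word_density n \<Phi> \<in> strategy_densities n b"
    using \<Phi> by (auto simp: strategy_densities_def K_def)
  have "F_min n (strategy_densities n b) F = ?E \<Phi>"
    unfolding F_min_def using mem least
    by (intro Least_equality) (auto simp: strategy_densities_def)
  with mem show ?thesis
    by (rule that)
qed

section \<open>The lower bound for the minimal expectation\<close>

theorem theorem1p13:
  fixes n r :: nat
    and b :: "real ^ 'm::finite"
    and u :: "nat \<Rightarrow> real ^ ('m letter)"
    and s :: "nat \<Rightarrow> real"
    and C :: real
  assumes "n \<ge> 1"
    and "densities b \<noteq> {}"
    and "\<And>j. j \<in> {1..r} \<Longrightarrow> ell_positive (u j)"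
    and "\<And>j. j \<in> {1..r} \<Longrightarrow> u j = pos_vec (u j)"
    and "\<And>j. j \<in> {1..r} \<Longrightarrow> s j \<ge> 0"
    and "C \<ge> 0"
  shows "F_min n (strategy_densities n b) (european r s u C) \<ge>
    (\<Sum>k | (\<Sum>i\<in>UNIV. k i) = n.
       fact n / (\<Prod>i\<in>UNIV. fact (k i)) * (\<Prod>i\<in>UNIV. beta b i ^ k i) *
       pos ((\<Sum>j=1..r. s j * (\<Prod>i\<in>UNIV. alpha (u j) i ^ k i)) - C))"
    (is "_ \<ge> ?rhs")
proof -
  define A where "A w = (\<Sum>j=1..r. s j * (\<Prod>k<n. alpha (u j) (w ! k)))" for w
  define I where "I v w = (\<Prod>k<n. zero_ind (v ! k) (w ! k))" for v :: "'m letter list" and w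
  let ?W = "{w :: 'm option list. length w = n}"
  have A_nonneg: "0 \<le> A w" for w
    unfolding A_def using assms(3-5)
    by (intro sum_nonneg mult_nonneg_nonneg prod_nonneg) (auto intro: alpha_nonneg)
  have I_01: "I v w \<in> {0, 1}" for v w
    unfolding I_def by (induction n) auto
  have european_ge: "(\<Sum>w\<in>?W. I v w * pos (A w - C)) \<le> european r s u C v" if "v \<in> words n" for v
  proof -
    \<comment> \<open>Choosing one index from the expansion of each factor amounts to choosing a
      word \<open>w\<close>.\<close>
    have "(\<Prod>k<n. u j $ (v ! k)) = (\<Sum>w\<in>?W. (\<Prod>k<n. alpha (u j) (w ! k)) * I v w)"
      if "j \<in> {1..r}" for j
      by (simp only: ell_positive_expand[OF assms(3)[OF that]] prod_sum_words prod.distrib I_def)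
    then have "(\<Sum>j=1..r. s j * (\<Prod>k<n. u j $ (v ! k)))
        = (\<Sum>j=1..r. \<Sum>w\<in>?W. s j * ((\<Prod>k<n. alpha (u j) (w ! k)) * I v w))"
      by (simp add: sum_distrib_left)
    also have "\<dots> = (\<Sum>w\<in>?W. I v w * A w)"
      unfolding A_def sum_distrib_left by (subst sum.swap) (simp add: mult_ac)
    finally have "european r s u C v = pos ((\<Sum>w\<in>?W. I v w * A w) - C)"
      using that by (simp add: european_def words_def)
    moreover have "(\<Sum>w\<in>?W. I v w * pos (A w - C)) \<le> (\<Sum>w\<in>?W. pos (I v w * A w - C))"
    proof (rule sum_mono)
      \<comment> \<open>Both sides agree if \<open>I v w = 1\<close>, and the left one vanishes if
        \<open>I v w = 0\<close>.\<close>
      show "I v w * pos (A w - C) \<le> pos (I v w * A w - C)" for w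
        using I_01[of v w] \<open>C \<ge> 0\<close> by (auto simp: pos_def)
    qed
    moreover have "\<dots> \<le> pos ((\<Sum>w\<in>?W. I v w * A w) - C)"
      using I_01[of v] A_nonneg \<open>C \<ge> 0\<close>
      by (intro pos_sum_ge finite_words mult_nonneg_nonneg) (auto simp: I_def intro!: prod_nonneg)
    ultimately show ?thesis
      by simp
  qed
  obtain P where P: "P \<in> strategy_densities n b"
    and F_min: "F_min n (strategy_densities n b) (european r s u C) = expect n P (european r s u C)"
    using F_min_attained[OF assms(2)] .
  from P obtain \<Phi> where \<Phi>: "\<Phi> \<in> short_words n \<rightarrow> densities b" and P_eq: "P = word_density n \<Phi>"
    by (auto simp: strategy_densities_def)
  have P_nonneg: "0 \<le> P v" if "v \<in> words n" for v
  proof -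
    have "\<Phi> (take k v) \<in> densities b" if "k < n" for k
      using \<Phi> that by (auto simp: short_words_def)
    with that show ?thesis
      by (auto simp: P_eq word_density_def densities_def intro!: prod_nonneg)
  qed
  have "?rhs = (\<Sum>w\<in>?W. (\<Prod>i\<in>UNIV. beta b i ^ count (mset w) i) *
      pos ((\<Sum>j=1..r. s j * (\<Prod>i\<in>UNIV. alpha (u j) i ^ count (mset w) i)) - C))"
    unfolding mult.assoc by (rule sum_words_count[symmetric])
  also have "\<dots> = (\<Sum>w\<in>?W. (\<Prod>k<n. beta b (w ! k)) * pos (A w - C))"
    by (intro sum.cong) (simp_all add: A_def prod_nth_eq_prod_power_count)
  \<comment> \<open>The product of the \<open>beta\<close> values is the expectation of
    \<open>I v w\<close> under the minimizing \<open>P\<close>; exchanging the sums then allows the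
    pointwise bound \<open>european_ge\<close>.\<close>
  also have "\<dots> = (\<Sum>w\<in>?W. (\<Sum>v\<in>words n. P v * I v w) * pos (A w - C))"
    by (intro sum.cong refl)
       (simp add: expect_zero_ind[OF \<Phi>, symmetric] P_eq word_density_def words_def I_def)
  also have "\<dots> = (\<Sum>v\<in>words n. P v * (\<Sum>w\<in>?W. I v w * pos (A w - C)))"
    unfolding sum_distrib_left sum_distrib_right by (subst sum.swap) (simp add: mult_ac)
  also have "\<dots> \<le> expect n P (european r s u C)"
    unfolding expect_def by (intro sum_mono mult_left_mono european_ge P_nonneg)
  finally show ?thesis
    unfolding F_min .
qed

end
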